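(* For $d \geq 3$ and $n \geq 2$ it holds \[\mathrm{qc}(n^{\times d}) \geq 2 \left \lfloor \frac{n^{d - 1}}{d - 1} \right \rfloor.\]
   Context: Search game on the grid $S_1\times\cdots\times S_d$ with $S_i=\{0,\ldots,n_i-1\}$: Adversary fixes a target $t$; Algorithm queries a point $q$; if $q\neq t$, Adversary answers for every coordinate $i$ one of $t_i<q_i$ or $t_i>q_i$, at least one of these $d$ inequalities being true, and Algorithm does not learn which one. $\mathrm{qc}(n_1,\ldots,n_d)$ denotes the minimum number of queries that guarantees finding the target (the query complexity); $\mathrm{qc}(n^{\times d})=\mathrm{qc}(n,\ldots,n)$. *)

theory Defs
  imports Main
begin

definition grid :: "nat list \<Rightarrow> nat list set" where
  "grid ns = {x. length x = length ns \<and> (\<forall>i<length ns. x ! i < ns ! i)}"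

datatype claim = Target_Less | Target_Greater

fun claim_holds :: "claim \<Rightarrow> nat \<Rightarrow> nat \<Rightarrow> bool" where
  "claim_holds Target_Less ti qi \<longleftrightarrow> ti < qi"
| "claim_holds Target_Greater ti qi \<longleftrightarrow> ti > qi"

definition valid_answer :: "nat list \<Rightarrow> nat list \<Rightarrow> claim list \<Rightarrow> bool" where
  "valid_answer t q a \<longleftrightarrow>
     length a = length q \<and> (\<exists>i<length q. claim_holds (a ! i) (t ! i) (q ! i))"

text \<open>Past queries with their answers, oldest first. A strategy chooses the next query
  from this information only.\<close>

type_synonym history = "(nat list \<times> claim list) list"
type_synonym strategy = "history \<Rightarrow> nat list"

text \<open>The histories that can arise against the target \<open>t\<close> while every query so far has
  missed it. As the answers range over all valid ones, nothing is lost by fixing \<open>t\<close>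
  in advance.\<close>

inductive unfinished :: "strategy \<Rightarrow> nat list \<Rightarrow> history \<Rightarrow> bool"
  for s :: strategy and t :: "nat list" where
  start: "unfinished s t []"
| miss: "unfinished s t h \<Longrightarrow> s h \<noteq> t \<Longrightarrow> valid_answer t (s h) a
    \<Longrightarrow> unfinished s t (h @ [(s h, a)])"

text \<open>The target counts as found when it is queried, and this query is counted: at most
  \<open>k\<close> queries are made iff \<open>k\<close> misses never occur.\<close>

definition finds_within :: "nat list \<Rightarrow> strategy \<Rightarrow> nat \<Rightarrow> bool" where
  "finds_within ns s k \<longleftrightarrow>
     (\<forall>h. s h \<in> grid ns) \<and> (\<forall>t\<in>grid ns. \<forall>h. unfinished s t h \<longrightarrow> length h < k)"

definition qc :: "nat list \<Rightarrow> nat" where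
  "qc ns = (LEAST k. \<exists>s. finds_within ns s k)"

text \<open>The minimum in the definition of \<open>qc\<close> is attained, and a miss can always be answered.\<close>

lemma finite_grid: "finite (grid ns)"
proof (rule finite_subset)
  show "grid ns \<subseteq> {x. set x \<subseteq> {..<Suc (sum_list ns)} \<and> length x = length ns}"
  proof
    fix x assume x: "x \<in> grid ns"
    have "y < Suc (sum_list ns)" if "y \<in> set x" for y
    proof -
      from that obtain i where i: "i < length x" "x ! i = y"
        by (auto simp: in_set_conv_nth)
      with x have "y < ns ! i" "ns ! i \<in> set ns" by (auto simp: grid_def)
      with member_le_sum_list[of "ns ! i" ns] show ?thesis by linarith
    qed
    with x show "x \<in> {x. set x \<subseteq> {..<Suc (sum_list ns)} \<and> length x = length ns}"
      by (auto simp: grid_def)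
  qed
  show "finite {x. set x \<subseteq> {..<Suc (sum_list ns)} \<and> length x = length ns}"
    by (rule finite_lists_length_eq) simp
qed

lemma unfinished_queries:
  "unfinished s t h \<Longrightarrow> i < length h \<Longrightarrow> s (take i h) \<noteq> t"
  by (induction rule: unfinished.induct) (auto simp: less_Suc_eq)

lemma ex_finds_within:
  assumes "\<forall>n\<in>set ns. n > 0"
  shows "\<exists>k s. finds_within ns s k"
proof -
  obtain xs where xs: "set xs = grid ns"
    using finite_grid finite_list by blast
  have "replicate (length ns) 0 \<in> grid ns"
    using assms by (auto simp: grid_def)
  then have ne: "xs \<noteq> []" using xs by auto
  define s :: strategy where "s = (\<lambda>h. xs ! (length h mod length xs))"
  have "s h \<in> grid ns" for h
    using ne by (simp add: s_def flip: xs)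
  moreover have "length h < length xs" if t: "t \<in> grid ns" and h: "unfinished s t h" for t h
  proof (rule ccontr)
    assume "\<not> length h < length xs"
    moreover obtain i where "i < length xs" "xs ! i = t"
      using t by (auto simp: in_set_conv_nth simp flip: xs)
    ultimately show False
      using unfinished_queries[OF h, of i] by (simp add: s_def)
  qed
  ultimately show ?thesis unfolding finds_within_def by blast
qed

lemma finds_within_qc:
  assumes "\<forall>n\<in>set ns. n > 0"
  shows "\<exists>s. finds_within ns s (qc ns)"
  unfolding qc_def by (rule LeastI_ex) (rule ex_finds_within[OF assms])

lemma ex_valid_answer:
  assumes "t \<in> grid ns" "q \<in> grid ns" "q \<noteq> t"
  shows "\<exists>a. valid_answer t q a"
proof -
  obtain i where i: "i < length q" "q ! i \<noteq> t ! i"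
    using assms by (auto simp: grid_def list_eq_iff_nth_eq)
  let ?a = "replicate (length q) (if t ! i < q ! i then Target_Less else Target_Greater)"
  have "valid_answer t q ?a"
    using i by (auto simp: valid_answer_def intro!: exI[of _ i])
  then show ?thesis by blast
qed

end

theory Submission
  imports Defs
begin

text \<open>A query \<open>q\<close> with its answer rules out exactly the points of one closed orthant at \<open>q\<close>.
  Restrict the targets to two consecutive layers \<open>sum_list t \<in> {m, m + 1}\<close> of the grid. If
  \<open>sum_list q \<le> m\<close>, then answering that the target is greater in every coordinate rules out
  at most \<open>q\<close> itself, and if \<open>sum_list q \<ge> m + 1\<close>, the opposite answer does the same. Hence
  every query removes at most one point, and the two layers together bound the query
  complexity from below.

  For each residue \<open>r\<close> modulo \<open>n\<close> there are \<open>n ^ (d - 1)\<close> points with coordinate sum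
  congruent to \<open>r\<close>. The \<open>2 * n ^ (d - 1)\<close> points with residue \<open>n - 2\<close> or \<open>n - 1\<close> split into
  pairs of consecutive layers according to the quotient of the sum by \<open>n\<close>. Because \<open>d \<ge> 3\<close>,
  the bound \<open>d * (n - 1)\<close> on the sums leaves only the \<open>d - 1\<close> quotients below \<open>d - 1\<close>, so
  one pair has at least \<open>2 * n ^ (d - 1) / (d - 1)\<close> points.\<close>

text \<open>The answer from \<open>spare\<close> is valid for all targets in \<open>C\<close> other
  than the query at once. So one common history stays open for every surviving target, and each
  query removes at most one of them. If \<open>card C\<close> exceeded \<open>k\<close>, some target
  would survive \<open>k\<close> misses.\<close>

lemma card_le_if_answers_spare_others:
  assumes "finds_within ns s k" and "C \<subseteq> grid ns"
    and spare: "\<And>q. q \<in> grid ns \<Longrightarrow> \<exists>a. \<forall>t\<in>C - {q}. valid_answer t q a"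
  shows "card C \<le> k"
proof -
  have fin: "finite C" using assms(2) finite_grid finite_subset by blast
  have sg: "s h \<in> grid ns" for h using assms(1) by (simp add: finds_within_def)
  have remaining: "\<exists>h. length h = m \<and> card C \<le> card {t\<in>C. unfinished s t h} + m" for m
  proof (induction m)
    case 0
    show ?case by (intro exI[of _ "[]"]) (simp add: unfinished.start)
  next
    case (Suc m)
    then obtain h where h: "length h = m" "card C \<le> card {t\<in>C. unfinished s t h} + m"
      by blast
    obtain a where a: "\<forall>t\<in>C - {s h}. valid_answer t (s h) a"
      using spare[OF sg] by blast
    let ?h' = "h @ [(s h, a)]"
    have "{t\<in>C. unfinished s t h} - {s h} \<subseteq> {t\<in>C. unfinished s t ?h'}"
      using a by (auto intro!: unfinished.miss)
    then have "card ({t\<in>C. unfinished s t h} - {s h}) \<le> card {t\<in>C. unfinished s t ?h'}"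
      using fin by (intro card_mono) auto
    moreover have "card {t\<in>C. unfinished s t h} - 1 \<le> card ({t\<in>C. unfinished s t h} - {s h})"
      using diff_card_le_card_Diff[of "{s h}" "{t\<in>C. unfinished s t h}"] by simp
    ultimately show ?case
      using h by (intro exI[of _ ?h']) auto
  qed
  show ?thesis
  proof (rule ccontr)
    assume less: "\<not> card C \<le> k"
    obtain h where h: "length h = k" "card C \<le> card {t\<in>C. unfinished s t h} + k"
      using remaining by blast
    with less have "card {t\<in>C. unfinished s t h} \<noteq> 0" by linarith
    then have "{t\<in>C. unfinished s t h} \<noteq> {}" by fastforce
    then obtain t where "t \<in> C" "unfinished s t h" by blast
    with h assms(1,2) show False by (auto simp: finds_within_def)
  qed
qed

lemma eq_if_list_all2_le_sum_list_ge:
  fixes xs ys :: "nat list"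
  assumes "list_all2 (\<le>) xs ys" and "sum_list ys \<le> sum_list xs"
  shows "xs = ys"
  using assms
proof (induction rule: list_all2_induct)
  case (Cons x xs y ys)
  have "sum_list xs \<le> sum_list ys"
    using Cons.hyps(2) by (induction rule: list_all2_induct) auto
  with Cons show ?case by auto
qed simp

lemma two_layers_spare_others:
  assumes "\<And>t. t \<in> C \<Longrightarrow> length t = length q \<and> sum_list t \<in> {m, Suc m}"
  shows "\<exists>a. \<forall>t\<in>C - {q}. valid_answer t q a"
proof (cases "sum_list q \<le> m")
  case True
  have "valid_answer t q (replicate (length q) Target_Greater)" if t: "t \<in> C - {q}" for t
  proof (rule ccontr)
    assume "\<not> ?thesis"
    \<comment> \<open>A target ruled out by this answer lies below \<open>q\<close> coordinatewise,
      yet its sum is at least \<open>m\<close> and hence not smaller than that of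
      \<open>q\<close>.\<close>
    then have "t ! i \<le> q ! i" if "i < length q" for i
      using that unfolding valid_answer_def
      by (metis claim_holds.simps(2) length_replicate not_less nth_replicate)
    then have "list_all2 (\<le>) t q"
      using t assms[of t] by (auto simp: list_all2_conv_all_nth)
    moreover have "sum_list q \<le> sum_list t" using t assms[of t] True by auto
    ultimately show False using t eq_if_list_all2_le_sum_list_ge by blast
  qed
  then show ?thesis by blast
next
  case False
  have "valid_answer t q (replicate (length q) Target_Less)" if t: "t \<in> C - {q}" for t
  proof (rule ccontr)
    assume "\<not> ?thesis"
    then have "q ! i \<le> t ! i" if "i < length q" for i
      using that unfolding valid_answer_def
      by (metis claim_holds.simps(1) length_replicate not_less nth_replicate)
    then have "list_all2 (\<le>) q t"
      using t assms[of t] by (auto simp: list_all2_conv_all_nth)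
    moreover have "sum_list t \<le> sum_list q" using t assms[of t] False by auto
    ultimately show False using t eq_if_list_all2_le_sum_list_ge by blast
  qed
  then show ?thesis by blast
qed

lemma grid_replicate: "grid (replicate d n) = {x. set x \<subseteq> {..<n} \<and> length x = d}"
  by (auto simp: grid_def in_set_conv_nth subset_iff)

lemma card_grid_replicate: "card (grid (replicate d n)) = n ^ d"
  by (simp add: grid_replicate card_lists_length_eq)

lemma sum_list_grid_replicate:
  assumes "x \<in> grid (replicate d n)"
  shows "sum_list x \<le> d * (n - 1)"
proof -
  have "set x \<subseteq> {..<n} \<Longrightarrow> sum_list x \<le> length x * (n - 1)"
    by (induction x) auto
  then show ?thesis using assms by (simp add: grid_replicate)
qed

text \<open>The last \<open>d\<close> coordinates are free, and they determine the first one, since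
  exactly one value below \<open>n\<close> completes the sum to residue \<open>r\<close>.\<close>

lemma card_grid_sum_list_mod:
  assumes "r < n"
  shows "card {x \<in> grid (replicate (Suc d) n). sum_list x mod n = r} = n ^ d"
proof -
  \<comment> \<open>This is \<open>r - sum_list y\<close> modulo \<open>n\<close>, with
    \<open>n\<close> added to avoid truncated subtraction.\<close>
  define f where "f y = (r + (n - sum_list y mod n)) mod n" for y :: "nat list"
  have f_less: "f y < n" for y using assms by (simp add: f_def)
  have f_sum: "(f y + sum_list y) mod n = r" for y
  proof -
    have "(f y + sum_list y) mod n = (r + (n - sum_list y mod n) + sum_list y mod n) mod n"
      unfolding f_def by (simp only: mod_add_left_eq mod_add_right_eq)
    also have "\<dots> = (r + n) mod n"
      using mod_less_divisor[of n "sum_list y"] assms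
      by (simp del: mod_less_divisor add: add.assoc)
    finally show ?thesis using assms by simp
  qed
  have f_uniq: "c = f y" if "c < n" "(c + sum_list y) mod n = r" for c y
  proof -
    have "(c + sum_list y) mod n = (f y + sum_list y) mod n"
      using that f_sum by simp
    then have "int n dvd int (c + sum_list y) - int (f y + sum_list y)"
      by (metis mod_eq_dvd_iff zmod_int)
    then have "int n dvd int c - int (f y)" by simp
    moreover have "\<bar>int c - int (f y)\<bar> < int n" using that f_less[of y] by linarith
    ultimately have "int c - int (f y) = 0"
      using zdvd_imp_le[of "int n" "\<bar>int c - int (f y)\<bar>"]
      by (cases "int c = int (f y)") auto
    then show ?thesis by simp
  qed
  have "bij_betw (\<lambda>y. f y # y) (grid (replicate d n))
    {x \<in> grid (replicate (Suc d) n). sum_list x mod n = r}"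
  proof (rule bij_betw_byWitness[where f' = tl])
    show "\<forall>x\<in>{x \<in> grid (replicate (Suc d) n). sum_list x mod n = r}. f (tl x) # tl x = x"
      using f_uniq[symmetric] by (auto simp: grid_replicate length_Suc_conv simp del: replicate_Suc)
    show "tl ` {x \<in> grid (replicate (Suc d) n). sum_list x mod n = r} \<subseteq> grid (replicate d n)"
      by (auto simp: grid_replicate length_Suc_conv simp del: replicate_Suc)
    show "(\<lambda>y. f y # y) ` grid (replicate d n)
        \<subseteq> {x \<in> grid (replicate (Suc d) n). sum_list x mod n = r}"
      using f_less f_sum by (auto simp: grid_replicate simp del: replicate_Suc)
  qed simp
  from bij_betw_same_card[OF this] show ?thesis by (simp only: card_grid_replicate)
qed

text \<open>Pigeonhole in a form without division: the common bound \<open>b\<close> will be the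
  query complexity, so no largest fiber has to be chosen.\<close>

lemma card_le_fiber_times:
  assumes "finite U" and "f ` U \<subseteq> {..<m}"
    and "\<And>k. k < m \<Longrightarrow> card {x\<in>U. f x = k} \<le> b"
  shows "card U \<le> m * (b :: nat)"
proof -
  have "card U = (\<Sum>k<m. card {x\<in>U. f x = k})"
    using sum_fun_comp[OF assms(1) finite_lessThan assms(2), of "\<lambda>_. 1 :: nat"] by simp
  also have "\<dots> \<le> (\<Sum>k<m. b)" by (rule sum_mono) (use assms(3) in auto)
  finally show ?thesis by simp
qed

theorem theorem3:
  fixes d n :: nat
  assumes "d \<ge> 3" and "n \<ge> 2"
  shows "qc (replicate d n) \<ge> 2 * (n ^ (d - 1) div (d - 1))"
proof -
  let ?G = "grid (replicate d n)"
  let ?A = "\<lambda>r. {x \<in> ?G. sum_list x mod n = r}"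
  define U where "U = ?A (n - 2) \<union> ?A (n - 1)"
  obtain s where s: "finds_within (replicate d n) s (qc (replicate d n))"
    using finds_within_qc[of "replicate d n"] assms by auto
  have "card (?A r) = n ^ (d - 1)" if "r < n" for r
    using card_grid_sum_list_mod[OF that, of "d - 1"] assms by simp
  moreover have "card U = card (?A (n - 2)) + card (?A (n - 1))"
    unfolding U_def using assms by (intro card_Un_disjoint) (auto simp: finite_grid)
  ultimately have card_U: "card U = 2 * n ^ (d - 1)" using assms by simp
  \<comment> \<open>The residues \<open>n - 2\<close> and \<open>n - 1\<close> are consecutive
    without wrapping around, so equal quotients mean adjacent layers.\<close>
  have sum_U: "sum_list x = sum_list x div n * n + (n - 2)
      \<or> sum_list x = Suc (sum_list x div n * n + (n - 2))" if "x \<in> U" for x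
  proof -
    have "sum_list x mod n = n - 2 \<or> sum_list x mod n = Suc (n - 2)"
      using that assms by (auto simp: U_def)
    then show ?thesis using div_mult_mod_eq[of "sum_list x" n] by (metis add_Suc_right)
  qed
  have "card U \<le> (d - 1) * qc (replicate d n)"
  proof (rule card_le_fiber_times)
    show "finite U" by (simp add: U_def finite_grid)
    show "(\<lambda>x. sum_list x div n) ` U \<subseteq> {..<d - 1}"
    proof (rule image_subsetI)
      fix x assume x: "x \<in> U"
      show "sum_list x div n \<in> {..<d - 1}"
      proof (rule ccontr)
        assume "\<not> ?thesis"
        then have "(d - 1) * n \<le> sum_list x div n * n" by simp
        then have "(d - 1) * n + (n - 2) \<le> sum_list x" using sum_U[OF x] by linarith
        also have "\<dots> \<le> d * (n - 1)"
          using x by (intro sum_list_grid_replicate) (auto simp: U_def)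
        \<comment> \<open>This contradicts \<open>d \<ge> 3\<close>, once
          \<open>d \<le> d * n\<close> ensures that the subtraction is not truncated.\<close>
        finally have "d * n - 2 \<le> d * n - d"
          using assms by (simp add: algebra_simps)
        moreover have "d \<le> d * n" using assms by simp
        ultimately show False using assms by linarith
      qed
    qed
    fix k
    let ?C = "{x \<in> U. sum_list x div n = k}"
    show "card ?C \<le> qc (replicate d n)"
    proof (rule card_le_if_answers_spare_others[OF s])
      show C: "?C \<subseteq> ?G" by (auto simp: U_def)
      fix q assume "q \<in> ?G"
      then show "\<exists>a. \<forall>t\<in>?C - {q}. valid_answer t q a"
        using C sum_U
        by (intro two_layers_spare_others[where m = "k * n + (n - 2)"])
          (auto simp: grid_replicate)
    qed
  qed
  moreover have "(d - 1) * (2 * (n ^ (d - 1) div (d - 1))) \<le> 2 * n ^ (d - 1)"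
    using div_times_less_eq_dividend[of "n ^ (d - 1)" "d - 1"]
    by (simp add: mult.commute mult.left_commute)
  ultimately have "(d - 1) * (2 * (n ^ (d - 1) div (d - 1))) \<le> (d - 1) * qc (replicate d n)"
    using card_U by linarith
  then show ?thesis using assms by simp
qed

end
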